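(* Let $w(t,x)$ be a time-dependent family of parametrized analytic curves $\Gamma_t=\{w(t,x): x\in\mathbb{R}\}$, obtained from nonsingular invertible holomorphic functions $z\mapsto w(t,z)$ defined for $z$ near the real axis, and let $S(t,z)=\bar w(t,w^{-1}(t,z))$ be the Schwarz function of $\Gamma_t$. Then $S(t,z)$ represents a geodesic $\Gamma_t$ in the space $\Lambda$ of analytic curves if and only if the parametrization $w(t,x)$ of $\Gamma_t$ satisfies $\mathrm{Im}[Q[w]]=0$, where $Q$ is the quartic second order partial differential operator $$Q[w]=w_x\bar w_x^2w_{tt}+(w_x\bar w_xw_t+w_x^2\bar w_t)\bar w_{xt}+\bar w_xw_t\bar w_tw_{xx}.$$ In the case of normal motion, $\langle w_x,w_t\rangle=0$, the equation $\mathrm{Im}[Q[w]]=0$ may be replaced by the system $$\mathrm{Im}\left[\bar w_x\left(|w_x|^2w_{tt}+|w_t|^2w_{xx}\right)\right]=0,\qquad w_t\bar w_x+\bar w_tw_x=0.$$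
   Context: Subscripts denote partial derivatives; the equations for $w$ are evaluated at real $t$ and real $x$, where $\bar w$ is the complex conjugate of $w$. For holomorphic $f$, $\bar f(z)=\overline{f(\bar z)}$, so $\bar w(t,x)=S(t,w(t,x))$, and $w^{-1}(t,\cdot)$ denotes the inverse of $z\mapsto w(t,z)$. $\langle a,b\rangle=\mathrm{Re}(a\bar b)$ is the Euclidean inner product on $\mathbb{C}$. Nonsingular means $w_x\neq0$. $\Lambda$ is the (formal) space of unparametrized analytic curves, identified with their Schwarz functions, with connection $\nabla_{S_r}S_t=S_{rt}-\frac{1}{2S_z}(S_{rz}S_t+S_{tz}S_r)$ for two-parameter families $S(r,t,z)$. "$S(t,z)$ represents a geodesic" means $\nabla_{S_t}S_t=0$, i.e. $S_{tt}-\frac{S_t}{S_z}S_{tz}=0$. *)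

theory Defs
  imports "HOL-Complex_Analysis.Complex_Analysis"
begin

section \<open>Partial derivatives\<close>

text \<open>The differentiation in \<open>t\<close> is generic in the second argument, so that it serves both
  functions of \<open>(t, x)\<close> with \<open>x\<close> real and functions of \<open>(t, z)\<close> with \<open>z\<close> complex.
  Iterated subscripts are read from left to right: \<open>f\<^sub>x\<^sub>t = (f\<^sub>x)\<^sub>t\<close>.\<close>

definition D_t :: "(real \<Rightarrow> 'b \<Rightarrow> complex) \<Rightarrow> real \<Rightarrow> 'b \<Rightarrow> complex" where
  "D_t f t y = vector_derivative (\<lambda>s. f s y) (at t)"

definition D_x :: "(real \<Rightarrow> real \<Rightarrow> complex) \<Rightarrow> real \<Rightarrow> real \<Rightarrow> complex" where
  "D_x u t x = vector_derivative (u t) (at x)"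

definition D_z :: "(real \<Rightarrow> complex \<Rightarrow> complex) \<Rightarrow> real \<Rightarrow> complex \<Rightarrow> complex" where
  "D_z S t z = deriv (S t) z"

section \<open>Families of parametrized analytic curves and their Schwarz functions\<close>

definition slice :: "(real \<times> complex) set \<Rightarrow> real \<Rightarrow> complex set" where
  "slice D t = {z. (t, z) \<in> D}"

text \<open>\<open>I\<close> is the set of times and \<open>slice D t\<close> the neighbourhood of the real axis on which
  \<open>w t\<close> lives; it may vary with \<open>t\<close> and need be neither connected nor symmetric under
  conjugation. The dependence on time is \<open>C\<^sup>2\<close>, jointly with \<open>z\<close>. Only \<open>t\<close>-derivatives are
  mentioned, since continuity of the \<open>z\<close>-derivatives follows from holomorphy.\<close>

definition analytic_curve_family ::
    "real set \<Rightarrow> (real \<times> complex) set \<Rightarrow> (real \<Rightarrow> complex \<Rightarrow> complex) \<Rightarrow> bool" where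
  "analytic_curve_family I D w \<longleftrightarrow>
     open I \<and> open D \<and> D \<subseteq> I \<times> UNIV \<and>
     (\<forall>t\<in>I. \<real> \<subseteq> slice D t) \<and>
     (\<forall>t\<in>I. w t holomorphic_on slice D t \<and> inj_on (w t) (slice D t) \<and>
            (\<forall>z\<in>slice D t. deriv (w t) z \<noteq> 0)) \<and>
     (\<forall>(t, z)\<in>D. (\<lambda>s. w s z) differentiable (at t) \<and>
                  (\<lambda>s. D_t w s z) differentiable (at t)) \<and>
     continuous_on D (\<lambda>(t, z). w t z) \<and>
     continuous_on D (\<lambda>(t, z). D_t w t z) \<and>
     continuous_on D (\<lambda>(t, z). D_t (D_t w) t z)"

definition real_param :: "(real \<Rightarrow> complex \<Rightarrow> complex) \<Rightarrow> real \<Rightarrow> real \<Rightarrow> complex" where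
  "real_param w t x = w t (complex_of_real x)"

definition curve :: "(real \<Rightarrow> complex \<Rightarrow> complex) \<Rightarrow> real \<Rightarrow> complex set" where
  "curve w t = range (real_param w t)"

definition conj_fun :: "(complex \<Rightarrow> complex) \<Rightarrow> complex \<Rightarrow> complex" where
  "conj_fun f z = cnj (f (cnj z))"

definition schwarz_function ::
    "(real \<times> complex) set \<Rightarrow> (real \<Rightarrow> complex \<Rightarrow> complex) \<Rightarrow> real \<Rightarrow> complex \<Rightarrow> complex" where
  "schwarz_function D w t z = conj_fun (w t) (the_inv_into (slice D t) (w t) z)"

section \<open>The connection and geodesics\<close>

text \<open>\<open>nabla S r t z\<close> is the value at \<open>(r, t, z)\<close> of the covariant derivative of \<open>S\<^sub>t\<close> along
  \<open>S\<^sub>r\<close>, for a two-parameter family \<open>S\<close>.\<close>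

definition nabla ::
    "(real \<Rightarrow> real \<Rightarrow> complex \<Rightarrow> complex) \<Rightarrow> real \<Rightarrow> real \<Rightarrow> complex \<Rightarrow> complex" where
  "nabla S r t z =
     (let S_r = (\<lambda>t z. D_t (\<lambda>q. S q t) r z);
          S_t = D_t (S r);
          S_z = D_z (S r)
      in D_t S_r t z
         - 1 / (2 * S_z t z) * (D_z S_r t z * S_t t z + D_z S_t t z * S_r t z))"

text \<open>For a one-parameter family \<open>S\<close>, the covariant derivative of \<open>S\<^sub>t\<close> along itself is obtained
  from the two-parameter family \<open>(r, t) \<mapsto> S (r + t)\<close>, whose two velocities both equal
  \<open>S\<^sub>t\<close>; cf. \<open>nabla_self_eq\<close> below.\<close>

definition nabla_self :: "(real \<Rightarrow> complex \<Rightarrow> complex) \<Rightarrow> real \<Rightarrow> complex \<Rightarrow> complex" where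
  "nabla_self S t z = nabla (\<lambda>r s. S (r + s)) 0 t z"

text \<open>A Schwarz function is a germ of an analytic function along its curve, so the geodesic
  equation is required on some neighbourhood of the curve \<open>\<Gamma> t\<close>, for each time \<open>t\<close>.\<close>

definition represents_geodesic ::
    "real set \<Rightarrow> (real \<Rightarrow> complex set) \<Rightarrow> (real \<Rightarrow> complex \<Rightarrow> complex) \<Rightarrow> bool" where
  "represents_geodesic I \<Gamma> S \<longleftrightarrow>
     (\<forall>t\<in>I. \<exists>U. open U \<and> \<Gamma> t \<subseteq> U \<and> (\<forall>z\<in>U. nabla_self S t z = 0))"

lemma has_vector_derivative_shift_iff:
  fixes f :: "real \<Rightarrow> 'a::real_normed_vector"
  shows "((\<lambda>s. f (c + s)) has_vector_derivative d) (at a) \<longleftrightarrow>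
         (f has_vector_derivative d) (at (c + a))"
proof -
  have translate: "((\<lambda>s. k + s) has_vector_derivative 1) (at x)" for k x :: real
    unfolding has_real_derivative_iff_has_vector_derivative[symmetric]
    by (auto intro!: derivative_eq_intros)
  show ?thesis
    using vector_diff_chain_at[OF translate[of c a], of f d]
      vector_diff_chain_at[OF translate[of "- c" "c + a"], of "\<lambda>s. f (c + s)" d]
    by (auto simp: o_def)
qed

lemma D_t_shift: "D_t (\<lambda>s. f (c + s)) t y = D_t f (c + t) y"
  unfolding D_t_def vector_derivative_def
  by (subst has_vector_derivative_shift_iff[of "\<lambda>s. f s y"]) simp

lemma nabla_self_eq:
  "nabla_self S t z = D_t (D_t S) t z - D_t S t z / D_z S t z * D_z (D_t S) t z"
proof -
  have "D_t (\<lambda>q. S (q + s)) 0 = D_t S s" for s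
    using D_t_shift[of S s 0] by (simp add: add.commute fun_eq_iff)
  then show ?thesis
    unfolding nabla_self_def nabla_def Let_def by (simp add: D_z_def)
qed

section \<open>The operator \<open>Q\<close> and normal motion\<close>

definition Q :: "(real \<Rightarrow> real \<Rightarrow> complex) \<Rightarrow> real \<Rightarrow> real \<Rightarrow> complex" where
  "Q u t x =
     (let ux = D_x u t x; ut = D_t u t x;
          uxx = D_x (D_x u) t x; uxt = D_t (D_x u) t x; utt = D_t (D_t u) t x
      in ux * (cnj ux)^2 * utt
         + (ux * cnj ux * ut + ux^2 * cnj ut) * cnj uxt
         + cnj ux * ut * cnj ut * uxx)"

definition normal_motion :: "real set \<Rightarrow> (real \<Rightarrow> real \<Rightarrow> complex) \<Rightarrow> bool" where
  "normal_motion I u \<longleftrightarrow> (\<forall>t\<in>I. \<forall>x. D_x u t x \<bullet> D_t u t x = 0)"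

definition normal_system :: "(real \<Rightarrow> real \<Rightarrow> complex) \<Rightarrow> real \<Rightarrow> real \<Rightarrow> bool" where
  "normal_system u t x \<longleftrightarrow>
     (let ux = D_x u t x; ut = D_t u t x; uxx = D_x (D_x u) t x; utt = D_t (D_t u) t x
      in Im (cnj ux * (of_real ((cmod ux)^2) * utt + of_real ((cmod ut)^2) * uxx)) = 0 \<and>
         ut * cnj ux + cnj ut * ux = 0)"

end

theory Submission imports Defs begin

text \<open>Write \<open>W(t, z)\<close> for the conjugate family, so that \<open>S(t, w(t, z)) = W(t, z)\<close>. Differentiating this
  identity gives \<open>S\<^sub>t(t, w) = P := W\<^sub>t - W\<^sub>z w\<^sub>t / w\<^sub>z\<close>, and once more \<open>\<nabla>S\<^sub>t(t, w) = P\<^sub>t - P\<^sub>z W\<^sub>t / W\<^sub>z\<close>. On the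
  real axis \<open>W\<close> and its derivatives are the conjugates of \<open>w\<close> and its derivatives, and multiplication
  by \<open>w\<^sub>z\<^sup>2 W\<^sub>z\<close> turns the right-hand side into \<open>cnj Q[w] - Q[w]\<close>. It is holomorphic in \<open>z\<close>, so by the identity
  theorem it vanishes on discs around the real points as soon as it vanishes on the real axis. For
  normal motion the coefficient of \<open>cnj w\<^sub>x\<^sub>t\<close> in \<open>Q[w]\<close> is zero.

  The regularity needed comes from two facts: a \<open>t\<close>-derivative that is jointly continuous is again
  holomorphic in \<open>z\<close> (Weierstrass), and \<open>(t, z) \<mapsto> (t, w(t, z))\<close> is a homeomorphism onto an open set
  by invariance of domain, hence its inverse is differentiable.\<close>

section \<open>Families of holomorphic functions\<close>

text \<open>Holomorphy is demanded at every real \<open>t\<close>; where the slice is empty this is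
  vacuous, so no set of times has to be carried along. Continuity of the \<open>z\<close>-derivative
  is a consequence, proved in \<open>continuous_on_D_z\<close>.\<close>

definition C1_family ::
    "(real \<times> complex) set \<Rightarrow> (real \<Rightarrow> complex \<Rightarrow> complex) \<Rightarrow> bool" where
  "C1_family D f \<longleftrightarrow>
     open D \<and> (\<forall>t. f t holomorphic_on slice D t) \<and>
     (\<forall>(t, z)\<in>D. ((\<lambda>s. f s z) has_vector_derivative D_t f t z) (at t)) \<and>
     continuous_on D (\<lambda>(t, z). f t z) \<and>
     continuous_on D (\<lambda>(t, z). D_t f t z)"

lemma slice_iff [simp]: "z \<in> slice D t \<longleftrightarrow> (t, z) \<in> D"
  by (simp add: slice_def)

lemma open_slice:
  assumes "open D" shows "open (slice D t)"
proof -
  have "slice D t = (\<lambda>z. (t, z)) -` D" by auto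
  then show ?thesis
    using assms by (simp add: open_vimage continuous_intros)
qed

text \<open>Puts a time derivative in the form in which the Weierstrass theorem delivers it: as a
  limit of complex difference quotients.\<close>

lemma has_vector_derivative_iff_diff_quotient:
  fixes f :: "real \<Rightarrow> complex"
  shows "(f has_vector_derivative v) (at t) \<longleftrightarrow>
         ((\<lambda>s. (f s - f t) / of_real (s - t)) \<longlongrightarrow> v) (at t)"
proof -
  have "norm ((f s - f t) / of_real (s - t) - v) = norm (f s - f t - (s - t) *\<^sub>R v) / norm (s - t)"
    if "s \<noteq> t" for s
  proof -
    have "(f s - f t) / of_real (s - t) - v = (f s - f t - (s - t) *\<^sub>R v) / of_real (s - t)"
      using that by (simp add: field_simps scaleR_conv_of_real)
    then show ?thesis
      by (simp only: norm_divide norm_of_real real_norm_def)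
  qed
  then have "((\<lambda>s. norm ((f s - f t) / of_real (s - t) - v)) \<longlongrightarrow> 0) (at t) \<longleftrightarrow>
        ((\<lambda>s. norm (f s - f t - (s - t) *\<^sub>R v) / norm (s - t)) \<longlongrightarrow> 0) (at t)"
    by (intro filterlim_cong) (auto simp: eventually_at_filter)
  moreover have "((\<lambda>s. (f s - f t) / of_real (s - t)) \<longlongrightarrow> v) (at t) \<longleftrightarrow>
        ((\<lambda>s. norm ((f s - f t) / of_real (s - t) - v)) \<longlongrightarrow> 0) (at t)"
    by (subst LIM_zero_iff[symmetric], subst tendsto_norm_zero_iff) (rule refl)
  ultimately show ?thesis
    unfolding has_vector_derivative_def has_derivative_iff_norm
    by (simp add: bounded_linear_scaleR_left)
qed

lemma open_timesE:
  fixes D :: "(real \<times> complex) set"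
  assumes "open D" "(t, z) \<in> D"
  obtains r where "r > 0" "ball t r \<times> cball z r \<subseteq> D"
proof -
  obtain A B where AB: "open A" "open B" "t \<in> A" "z \<in> B" "A \<times> B \<subseteq> D"
    using open_prod_elim[OF assms] by (metis mem_Sigma_iff)
  obtain a where a: "a > 0" "ball t a \<subseteq> A"
    using AB(1,3) by (auto simp: open_contains_ball)
  obtain b where b: "b > 0" "cball z b \<subseteq> B"
    using AB(2,4) by (auto simp: open_contains_cball)
  have "ball t (min a b) \<subseteq> A" "cball z (min a b) \<subseteq> B"
    using a(2) b(2) by auto
  then have "ball t (min a b) \<times> cball z (min a b) \<subseteq> D"
    using AB(5) by blast
  then show thesis using a(1) b(1) by (intro that[of "min a b"]) auto
qed

lemma D_z_has_derivative:
  assumes "open D" "f t holomorphic_on slice D t" "(t, z) \<in> D"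
  shows "(f t has_field_derivative D_z f t z) (at z)"
  unfolding D_z_def
  using assms by (intro holomorphic_derivI[OF _ open_slice]) auto

text \<open>Translating the second argument turns convergence in \<open>z\<close> into convergence of functions on a
  fixed disc, so that a single application of the Weierstrass convergence theorem gives continuity
  in both variables at once.\<close>

lemma continuous_on_D_z:
  assumes "open D" and hol: "\<And>t. f t holomorphic_on slice D t"
    and cont: "continuous_on D (\<lambda>(t, z). f t z)"
  shows "continuous_on D (\<lambda>(t, z). D_z f t z)"
proof -
  have "isCont (\<lambda>(t, z). D_z f t z) (t0, z0)" if D: "(t0, z0) \<in> D" for t0 z0
  proof -
    obtain r where r: "r > 0" "ball t0 r \<times> cball z0 r \<subseteq> D"
      using open_timesE[OF assms(1) D] .
    \<comment> \<open>Halving leaves room for two displacements: moving the centre by less than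
      \<open>\<rho>\<close> and the point by at most \<open>\<rho>\<close> stays within distance
      \<open>r\<close> of \<open>z0\<close>.\<close>
    define \<rho> where "\<rho> = r / 2"
    define U where "U = ball t0 r \<times> ball z0 \<rho>"
    define \<phi> where "\<phi> = (\<lambda>p u. f (fst p) (u + snd p - z0))"
    have "\<rho> > 0" using r by (simp add: \<rho>_def)
    have U: "open U" "(t0, z0) \<in> U" using r \<open>\<rho> > 0\<close> by (auto simp: U_def open_Times)
    have inD: "(fst p, u + snd p - z0) \<in> D" if "p \<in> U" "u \<in> cball z0 \<rho>" for p u
    proof -
      have "norm (z0 - snd p) < \<rho>" "norm (z0 - u) \<le> \<rho>"
        using that by (auto simp: U_def dist_norm)
      then have "norm ((z0 - snd p) + (z0 - u)) \<le> r"
        using norm_triangle_ineq[of "z0 - snd p" "z0 - u"] by (simp add: \<rho>_def)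
      then show ?thesis
        using that r(2) by (auto simp: U_def dist_norm subset_iff mem_Times_iff algebra_simps)
    qed
    have "continuous_on (U \<times> cball z0 \<rho>)
        ((\<lambda>(t, z). f t z) \<circ> (\<lambda>(p, u). (fst p, u + snd p - z0)))"
      using inD by (intro continuous_on_compose continuous_on_subset[OF cont])
        (auto simp: case_prod_beta intro!: continuous_intros)
    then have cont': "continuous_on (U \<times> cball z0 \<rho>) (\<lambda>(p, u). \<phi> p u)"
      by (simp add: o_def case_prod_beta \<phi>_def)
    have ulim: "uniform_limit (cball z0 \<rho>) \<phi> (\<phi> (t0, z0)) (at (t0, z0))"
    proof (rule uniform_limitI)
      fix e :: real assume "e > 0"
      obtain X where X: "(t0, z0) \<in> X" "open X"
          "\<forall>p\<in>X \<inter> U. \<forall>u\<in>cball z0 \<rho>. dist (\<phi> p u) (\<phi> (t0, z0) u) \<le> e / 2"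
        using continuous_on_prod_compactE[OF cont' compact_cball U(2), of "e / 2"] \<open>e > 0\<close>
        by (auto simp del: mem_cball)
      show "\<forall>\<^sub>F p in at (t0, z0). \<forall>u\<in>cball z0 \<rho>. dist (\<phi> p u) (\<phi> (t0, z0) u) < e"
        unfolding eventually_at_topological
      proof (intro exI[of _ "X \<inter> U"] conjI ballI impI)
        show "open (X \<inter> U)" "(t0, z0) \<in> X \<inter> U" using X U by auto
        show "dist (\<phi> p u) (\<phi> (t0, z0) u) < e" if "p \<in> X \<inter> U" "u \<in> cball z0 \<rho>" for p u
          using X(3)[rule_format, OF that] \<open>e > 0\<close> by linarith
      qed
    qed
    have der: "(\<phi> p has_field_derivative D_z f (fst p) (u + snd p - z0)) (at u)"
      if "p \<in> U" "u \<in> cball z0 \<rho>" for p u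
    proof -
      have "(f (fst p) has_field_derivative D_z f (fst p) (u + snd p - z0)) (at (u + snd p - z0))"
        using D_z_has_derivative[of D f "fst p", OF assms(1) hol inD[OF that]] .
      moreover have "((\<lambda>u. u + snd p - z0) has_field_derivative 1) (at u)"
        by (auto intro!: derivative_eq_intros)
      ultimately show ?thesis
        unfolding \<phi>_def
        using DERIV_chain2[of "f (fst p)" _ "\<lambda>u. u + snd p - z0" u 1 UNIV] by simp
    qed
    have "\<forall>\<^sub>F p in at (t0, z0). p \<in> U"
      using U by (intro eventually_at_topological[THEN iffD2]) auto
    then have "\<forall>\<^sub>F p in at (t0, z0). continuous_on (cball z0 \<rho>) (\<phi> p) \<and>
        (\<forall>u\<in>ball z0 \<rho>. (\<phi> p has_field_derivative D_z f (fst p) (u + snd p - z0)) (at u))"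
    proof eventually_elim
      case (elim p)
      then show ?case
        using der[OF elim] ball_subset_cball by (intro conjI continuous_at_imp_continuous_on ballI) (blast intro: DERIV_isCont)+
    qed
    from has_complex_derivative_uniform_limit[OF this ulim _ \<open>\<rho> > 0\<close>]
    obtain g' where g': "\<And>u. u \<in> ball z0 \<rho> \<Longrightarrow> (\<phi> (t0, z0) has_field_derivative g' u) (at u) \<and>
        ((\<lambda>p. D_z f (fst p) (u + snd p - z0)) \<longlongrightarrow> g' u) (at (t0, z0))"
      by (auto simp del: mem_ball)
    \<comment> \<open>The Weierstrass theorem yields some derivative of the limit function;
      uniqueness of derivatives identifies it.\<close>
    have "g' z0 = D_z f t0 z0"
      using g'[of z0] der[OF U(2), of z0] \<open>\<rho> > 0\<close> by (auto dest: DERIV_unique)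
    then show ?thesis
      using g'[of z0] \<open>\<rho> > 0\<close> by (simp add: isCont_def case_prod_unfold)
  qed
  then show ?thesis
    by (intro continuous_at_imp_continuous_on) auto
qed

text \<open>The difference quotients \<open>q s\<close> in time are holomorphic in \<open>z\<close>
  and converge to \<open>D_t f t0\<close> uniformly on a disc. The Weierstrass theorem then gives
  both claims at once: the limit is holomorphic, and the \<open>z\<close>-derivatives of the
  quotients converge to its derivative, which is the exchange of the two differentiations.\<close>

lemma
  assumes "C1_family D f" "(t0, z0) \<in> D"
  shows D_t_has_derivative: "(D_t f t0 has_field_derivative D_z (D_t f) t0 z0) (at z0)"
    and D_z_has_vector_derivative:
      "((\<lambda>t. D_z f t z0) has_vector_derivative D_z (D_t f) t0 z0) (at t0)"
proof -
  have oD: "open D" and hol: "\<And>t. f t holomorphic_on slice D t"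
    and vd: "\<And>t z. (t, z) \<in> D \<Longrightarrow> ((\<lambda>s. f s z) has_vector_derivative D_t f t z) (at t)"
    and cont: "continuous_on D (\<lambda>(t, z). D_t f t z)"
    using assms(1) by (auto simp: C1_family_def)
  obtain r where r: "r > 0" "ball t0 r \<times> cball z0 r \<subseteq> D"
    using open_timesE[OF oD assms(2)] .
  define q where "q = (\<lambda>s z. (f s z - f t0 z) / of_real (s - t0))"
  have ulim: "uniform_limit (cball z0 r) q (D_t f t0) (at t0)"
  proof (rule uniform_limitI)
    fix e :: real assume "e > 0"
    have "t0 \<in> ball t0 r" "e / 2 > 0" using r \<open>e > 0\<close> by auto
    from continuous_on_prod_compactE[OF continuous_on_subset[OF cont r(2)] compact_cball this]
    obtain X where X: "t0 \<in> X" "open X"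
        "\<forall>s\<in>X \<inter> ball t0 r. \<forall>u\<in>cball z0 r. dist (D_t f s u) (D_t f t0 u) \<le> e / 2"
      by (auto simp del: mem_cball mem_ball)
    have "open (X \<inter> ball t0 r)" "t0 \<in> X \<inter> ball t0 r" using X(1,2) r by auto
    then obtain d where d: "d > 0" "ball t0 d \<subseteq> X \<inter> ball t0 r"
      by (meson open_contains_ball)
    have "dist (q s u) (D_t f t0 u) < e" if s: "s \<noteq> t0" "dist s t0 < d" and u: "u \<in> cball z0 r" for s u
    proof -
      \<comment> \<open>Mean value inequality in time: on \<open>ball t0 d\<close> the derivative
        \<open>D_t f\<close> differs from its value at \<open>t0\<close> by at most
        \<open>e / 2\<close>, with the same \<open>d\<close> for all \<open>u\<close> in the
        disc.\<close>
      have "norm (f s u - f t0 u - (s - t0) *\<^sub>R D_t f t0 u) \<le> norm (s - t0) * (e / 2)"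
      proof (rule vector_differentiable_bound_linearization[where S = "ball t0 d"
            and f = "\<lambda>s. f s u" and f' = "\<lambda>s. D_t f s u"])
        show "((\<lambda>s. f s u) has_vector_derivative D_t f x u) (at x within ball t0 d)"
          if "x \<in> ball t0 d" for x
        proof -
          have "(x, u) \<in> D" using that d(2) r(2) u by (meson IntD2 SigmaI subsetD)
          then show ?thesis using vd has_vector_derivative_at_within by blast
        qed
        show "closed_segment t0 s \<subseteq> ball t0 d"
          using s d by (intro closed_segment_subset) (auto simp: dist_commute)
        show "norm (D_t f x u - D_t f t0 u) \<le> e / 2" if "x \<in> ball t0 d" for x
          using X(3) that d u by (metis dist_norm in_mono)
        show "t0 \<in> ball t0 d" using d by simp
      qed
      moreover have "q s u - D_t f t0 u = (f s u - f t0 u - (s - t0) *\<^sub>R D_t f t0 u) / of_real (s - t0)"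
        using s by (simp add: q_def field_simps scaleR_conv_of_real)
      ultimately have "norm (q s u - D_t f t0 u) * norm (s - t0) \<le> (e / 2) * norm (s - t0)"
        using s by (simp add: norm_divide mult.commute del: of_real_diff)
      then have "norm (q s u - D_t f t0 u) \<le> e / 2"
        using s by (simp only: mult_le_cancel_right_pos zero_less_norm_iff right_minus_eq not_False_eq_True)
      then show ?thesis using \<open>e > 0\<close> by (simp add: dist_norm)
    qed
    then show "\<forall>\<^sub>F s in at t0. \<forall>u\<in>cball z0 r. dist (q s u) (D_t f t0 u) < e"
      unfolding eventually_at using d(1) by (intro exI[of _ d]) auto
  qed
  have der: "(q s has_field_derivative (D_z f s u - D_z f t0 u) / of_real (s - t0)) (at u)"
    if "s \<in> ball t0 r" "u \<in> cball z0 r" for s u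
  proof -
    have "(s, u) \<in> D" "(t0, u) \<in> D" using that r by auto
    then show ?thesis
      unfolding q_def using D_z_has_derivative[of D f, OF oD hol]
      by (intro DERIV_cdivide DERIV_diff) auto
  qed
  have "\<forall>\<^sub>F s in at t0. s \<in> ball t0 r"
    using r by (intro eventually_at_topological[THEN iffD2] exI[of _ "ball t0 r"]) auto
  then have "\<forall>\<^sub>F s in at t0. continuous_on (cball z0 r) (q s) \<and>
      (\<forall>u\<in>ball z0 r. (q s has_field_derivative (D_z f s u - D_z f t0 u) / of_real (s - t0)) (at u))"
  proof eventually_elim
    case (elim s)
    then show ?case
      using der[OF elim] ball_subset_cball by (intro conjI continuous_at_imp_continuous_on ballI) (blast intro: DERIV_isCont)+
  qed
  from has_complex_derivative_uniform_limit[OF this ulim _ \<open>r > 0\<close>]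
  obtain g' where g': "\<And>u. u \<in> ball z0 r \<Longrightarrow> (D_t f t0 has_field_derivative g' u) (at u) \<and>
      ((\<lambda>s. (D_z f s u - D_z f t0 u) / of_real (s - t0)) \<longlongrightarrow> g' u) (at t0)"
    by (auto simp del: mem_ball)
  have "z0 \<in> ball z0 r" using r by simp
  note g0 = g'[OF this]
  have eq: "g' z0 = D_z (D_t f) t0 z0"
    unfolding D_z_def using g0 by (intro DERIV_imp_deriv[symmetric]) blast
  show "(D_t f t0 has_field_derivative D_z (D_t f) t0 z0) (at z0)"
    using g0 eq by simp
  show "((\<lambda>t. D_z f t z0) has_vector_derivative D_z (D_t f) t0 z0) (at t0)"
    using g0 eq by (simp add: has_vector_derivative_iff_diff_quotient)
qed

text \<open>Allows the time derivative to be supplied as an explicit formula \<open>f'\<close>, as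
  the product and quotient rules do.\<close>

lemma C1_familyI:
  assumes "open D" "\<And>t. f t holomorphic_on slice D t"
    and vd: "\<And>t z. (t, z) \<in> D \<Longrightarrow> ((\<lambda>s. f s z) has_vector_derivative f' t z) (at t)"
    and "continuous_on D (\<lambda>(t, z). f t z)"
    and cont: "continuous_on D (\<lambda>(t, z). f' t z)"
  shows "C1_family D f"
proof -
  have eq: "D_t f t z = f' t z" if "(t, z) \<in> D" for t z
    using vd[OF that] by (simp add: D_t_def vector_derivative_at)
  have "continuous_on D (\<lambda>(t, z). D_t f t z)"
    using cont by (rule continuous_on_cong[THEN iffD1, rotated -1]) (auto simp: eq)
  then show ?thesis
    using assms by (auto simp: C1_family_def eq)
qed

lemma
  assumes "C1_family D f"
  shows C1_family_open: "open D"
    and C1_family_holomorphic: "f t holomorphic_on slice D t"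
    and C1_family_has_vector_derivative:
      "(t, z) \<in> D \<Longrightarrow> ((\<lambda>s. f s z) has_vector_derivative D_t f t z) (at t)"
    and C1_family_has_field_derivative:
      "(t, z) \<in> D \<Longrightarrow> (f t has_field_derivative D_z f t z) (at z)"
    and C1_family_continuous: "continuous_on D (\<lambda>p. f (fst p) (snd p))"
    and C1_family_continuous_D_t: "continuous_on D (\<lambda>p. D_t f (fst p) (snd p))"
    and C1_family_continuous_D_z: "continuous_on D (\<lambda>p. D_z f (fst p) (snd p))"
    and C1_family_holomorphic_D_t: "D_t f t holomorphic_on slice D t"
    and C1_family_holomorphic_D_z: "D_z f t holomorphic_on slice D t"
proof -
  show "open D" and hol: "f t holomorphic_on slice D t" for t
    using assms by (auto simp: C1_family_def)
  show "(t, z) \<in> D \<Longrightarrow> ((\<lambda>s. f s z) has_vector_derivative D_t f t z) (at t)" for t z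
    using assms by (auto simp: C1_family_def)
  show "(t, z) \<in> D \<Longrightarrow> (f t has_field_derivative D_z f t z) (at z)" for t z
    using D_z_has_derivative \<open>open D\<close> hol by blast
  show "continuous_on D (\<lambda>p. f (fst p) (snd p))" "continuous_on D (\<lambda>p. D_t f (fst p) (snd p))"
    using assms by (auto simp: C1_family_def case_prod_unfold)
  show "continuous_on D (\<lambda>p. D_z f (fst p) (snd p))"
    using continuous_on_D_z[of D f] assms by (auto simp: C1_family_def case_prod_unfold)
  show "D_t f t holomorphic_on slice D t"
    using D_t_has_derivative[OF assms] holomorphic_on_open[OF open_slice[OF \<open>open D\<close>]]
    by (metis slice_iff)
  show "D_z f t holomorphic_on slice D t"
    unfolding D_z_def[abs_def] using hol \<open>open D\<close> open_slice by (intro holomorphic_deriv) auto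
qed

lemma C1_family_subset:
  assumes "C1_family D f" "open E" "E \<subseteq> D"
  shows "C1_family E f"
proof -
  have "f t holomorphic_on slice E t" for t
    using assms(3) by (intro holomorphic_on_subset[OF C1_family_holomorphic[OF assms(1)]]) auto
  then show ?thesis
    using assms unfolding C1_family_def by (auto intro: continuous_on_subset)
qed

lemma D_t_D_z:
  assumes "C1_family D f" "(t, z) \<in> D"
  shows "D_t (D_z f) t z = D_z (D_t f) t z"
  using D_z_has_vector_derivative[OF assms] by (simp add: D_t_def vector_derivative_at)

text \<open>The time derivative of \<open>D_z f\<close> is \<open>D_z (D_t f)\<close>, and this is
  jointly continuous because \<open>continuous_on_D_z\<close> applies to \<open>D_t f\<close>, which
  is holomorphic in \<open>z\<close>.\<close>

lemma C1_family_D_z: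
  assumes "C1_family D f"
  shows "C1_family D (D_z f)"
proof (rule C1_familyI)
  show "continuous_on D (\<lambda>(t, z). D_z (D_t f) t z)"
    using assms by (intro continuous_on_D_z C1_family_open C1_family_holomorphic_D_t)
      (auto simp: case_prod_unfold intro: C1_family_continuous_D_t)
qed (use assms in \<open>auto simp: case_prod_unfold intro: C1_family_open C1_family_holomorphic_D_z
      D_z_has_vector_derivative C1_family_continuous_D_z\<close>)

section \<open>Closure of families under arithmetic operations\<close>

lemma C1_family_diff:
  assumes "C1_family D f" "C1_family D g"
  shows "C1_family D (\<lambda>t z. f t z - g t z)"
  by (rule C1_familyI[where f' = "\<lambda>t z. D_t f t z - D_t g t z"])
    (use assms in \<open>auto simp: case_prod_unfold intro!: holomorphic_intros continuous_intros
      has_vector_derivative_diff intro: C1_family_open C1_family_holomorphic C1_family_continuous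
      C1_family_continuous_D_t C1_family_has_vector_derivative\<close>)

lemma C1_family_mult:
  assumes "C1_family D f" "C1_family D g"
  shows "C1_family D (\<lambda>t z. f t z * g t z)"
  by (rule C1_familyI[where f' = "\<lambda>t z. f t z * D_t g t z + D_t f t z * g t z"])
    (use assms in \<open>auto simp: case_prod_unfold intro!: holomorphic_intros continuous_intros
      has_vector_derivative_mult intro: C1_family_open C1_family_holomorphic C1_family_continuous
      C1_family_continuous_D_t C1_family_has_vector_derivative\<close>)

lemma has_vector_derivative_divide_complex:
  fixes f g :: "real \<Rightarrow> complex"
  assumes "(f has_vector_derivative f') (at t)" "(g has_vector_derivative g') (at t)" "g t \<noteq> 0"
  shows "((\<lambda>s. f s / g s) has_vector_derivative f' / g t - f t * g' / (g t)^2) (at t)"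
proof -
  have "(inverse has_field_derivative - (inverse (g t) ^ Suc (Suc 0))) (at (g t))"
    using assms(3) by (rule DERIV_inverse)
  then have "(inverse \<circ> g has_vector_derivative g' * - (inverse (g t) ^ Suc (Suc 0))) (at t)"
    using assms(2) by (intro field_vector_diff_chain_at)
  from has_vector_derivative_mult[OF assms(1) this] show ?thesis
    by (simp add: o_def field_simps power2_eq_square)
qed

lemma C1_family_divide:
  assumes "C1_family D f" "C1_family D g" "\<And>t z. (t, z) \<in> D \<Longrightarrow> g t z \<noteq> 0"
  shows "C1_family D (\<lambda>t z. f t z / g t z)"
  by (rule C1_familyI[where f' = "\<lambda>t z. D_t f t z / g t z - f t z * D_t g t z / (g t z)^2"])
    (use assms in \<open>auto simp: case_prod_unfold intro!: holomorphic_intros continuous_intros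
      has_vector_derivative_divide_complex intro: C1_family_open C1_family_holomorphic
      C1_family_continuous C1_family_continuous_D_t C1_family_has_vector_derivative\<close>)

section \<open>Conjugation and transport along the family\<close>

definition conj_domain :: "(real \<times> complex) set \<Rightarrow> (real \<times> complex) set" where
  "conj_domain D = {(t, z). (t, cnj z) \<in> D}"

lemma conj_domain_iff [simp]: "(t, z) \<in> conj_domain D \<longleftrightarrow> (t, cnj z) \<in> D"
  by (simp add: conj_domain_def)

lemma open_conj_domain:
  assumes "open D"
  shows "open (conj_domain D)"
proof -
  have "conj_domain D = (\<lambda>p. (fst p, cnj (snd p))) -` D"
    by auto
  then show ?thesis
    using assms by (simp add: open_vimage continuous_intros)
qed

text \<open>Conjugation is real linear, hence commutes with the time derivative; conjugating both
  argument and value preserves holomorphy and conjugates the complex derivative in the same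
  way.\<close>

lemma
  assumes "C1_family D f"
  shows C1_family_conj: "C1_family (conj_domain D) (\<lambda>t. conj_fun (f t))"
    and D_t_conj: "(t, cnj z) \<in> D \<Longrightarrow> D_t (\<lambda>t. conj_fun (f t)) t z = cnj (D_t f t (cnj z))"
    and D_z_conj: "(t, cnj z) \<in> D \<Longrightarrow> D_z (\<lambda>t. conj_fun (f t)) t z = cnj (D_z f t (cnj z))"
proof -
  have eq: "conj_fun g = cnj \<circ> g \<circ> cnj" for g
    by (auto simp: conj_fun_def)
  have cnj_cont: "continuous_on (conj_domain D) (\<lambda>p. cnj (h (fst p) (cnj (snd p))))"
    if "continuous_on D (\<lambda>p. h (fst p) (snd p))" for h
  proof -
    have "continuous_on (conj_domain D) ((\<lambda>p. h (fst p) (snd p)) \<circ> (\<lambda>p. (fst p, cnj (snd p))))"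
      by (intro continuous_on_compose continuous_on_subset[OF that])
        (auto intro!: continuous_intros)
    then show ?thesis
      by (intro continuous_on_cnj) (simp add: o_def)
  qed
  have vd: "((\<lambda>t. conj_fun (f t) z) has_vector_derivative cnj (D_t f t (cnj z))) (at t)"
    if "(t, cnj z) \<in> D" for t z
    unfolding conj_fun_def
    using that assms by (intro has_vector_derivative_cnj C1_family_has_vector_derivative)
  show "C1_family (conj_domain D) (\<lambda>t. conj_fun (f t))"
  proof (rule C1_familyI)
    show od: "open (conj_domain D)"
      using assms by (intro open_conj_domain C1_family_open)
    show "conj_fun (f t) holomorphic_on slice (conj_domain D) t" for t
      unfolding eq using od C1_family_holomorphic[OF assms, of t]
      by (intro holomorphic_on_compose_cnj_cnj open_slice) (auto elim: holomorphic_on_subset)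
    show "((\<lambda>t. conj_fun (f t) z) has_vector_derivative cnj (D_t f t (cnj z))) (at t)"
      if "(t, z) \<in> conj_domain D" for t z
      using vd that by simp
    show "continuous_on (conj_domain D) (\<lambda>(t, z). conj_fun (f t) z)"
      "continuous_on (conj_domain D) (\<lambda>(t, z). cnj (D_t f t (cnj z)))"
      using cnj_cont[OF C1_family_continuous[OF assms]]
        cnj_cont[OF C1_family_continuous_D_t[OF assms]]
      by (auto simp: conj_fun_def case_prod_unfold)
  qed
  show "D_t (\<lambda>t. conj_fun (f t)) t z = cnj (D_t f t (cnj z))" if "(t, cnj z) \<in> D"
    using vd[OF that] by (simp add: D_t_def vector_derivative_at)
  show "D_z (\<lambda>t. conj_fun (f t)) t z = cnj (D_z f t (cnj z))" if "(t, cnj z) \<in> D"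
    using C1_family_has_field_derivative[OF assms that]
    unfolding D_z_def eq by (intro DERIV_imp_deriv) (simp add: has_field_derivative_cnj_cnj)
qed

section \<open>Joint differentiability and the inverse of the family\<close>

lemma C1_family_has_derivative:
  assumes "C1_family D f" "(t, z) \<in> D"
  shows "((\<lambda>p. f (fst p) (snd p)) has_derivative
          (\<lambda>h. fst h *\<^sub>R D_t f t z + D_z f t z * snd h)) (at (t, z))"
proof -
  obtain r where r: "r > 0" "ball t r \<times> cball z r \<subseteq> D"
    using open_timesE[OF C1_family_open[OF assms(1)] assms(2)] .
  have inD: "(s, u) \<in> D" if "u \<in> ball z r" "s \<in> ball t r" for s u
    using that r by (auto simp: subset_iff)
  \<comment> \<open>The variables are swapped because \<open>has_derivative_partialsI\<close> takes
    a continuous partial derivative in the second variable, and \<open>D_t f\<close> is continuous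
    as part of \<open>C1_family\<close>.\<close>
  have "((\<lambda>(u, s). f s u) has_derivative
         (\<lambda>(du, ds). D_z f t z * du + blinfun_scaleR_left (D_t f t z) ds))
        (at (z, t) within ball z r \<times> ball t r)"
  proof (rule has_derivative_partialsI[where fy = "\<lambda>u s. blinfun_scaleR_left (D_t f s u)"])
    show "(f t has_derivative (*) (D_z f t z)) (at z within ball z r)"
      using C1_family_has_field_derivative[OF assms]
      unfolding has_field_derivative_def by (rule has_derivative_at_withinI)
    show "((\<lambda>s. f s u) has_derivative blinfun_scaleR_left (D_t f s u)) (at s within ball t r)"
      if "u \<in> ball z r" "s \<in> ball t r" for u s
      using C1_family_has_vector_derivative[OF assms(1) inD[OF that]]
      by (simp add: has_vector_derivative_def has_derivative_at_withinI)
    have "continuous_on (ball z r \<times> ball t r)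
        ((\<lambda>p. D_t f (fst p) (snd p)) \<circ> (\<lambda>p. (snd p, fst p)))"
      using inD by (intro continuous_on_compose continuous_on_subset[OF C1_family_continuous_D_t[OF assms(1)]])
        (auto intro!: continuous_intros)
    then have "continuous_on (ball z r \<times> ball t r) (\<lambda>p. blinfun_scaleR_left (D_t f (snd p) (fst p)))"
      by (intro bounded_linear.continuous_on[OF bounded_linear_blinfun_scaleR_left]) (simp add: o_def)
    then show "continuous (at (z, t) within ball z r \<times> ball t r)
        (\<lambda>(u, s). blinfun_scaleR_left (D_t f s u))"
      using r by (simp add: continuous_on_eq_continuous_within case_prod_unfold)
  qed (use r in auto)
  moreover have "open (ball z r \<times> ball t r)" "(z, t) \<in> ball z r \<times> ball t r"
    using r by (auto simp: open_Times)
  ultimately have "((\<lambda>p. f (snd p) (fst p)) has_derivative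
         (\<lambda>h. D_z f t z * fst h + snd h *\<^sub>R D_t f t z)) (at (z, t))"
    by (simp add: at_within_open[of _ "ball z r \<times> ball t r"] case_prod_unfold)
  moreover have "((\<lambda>p. (snd p, fst p)) has_derivative (\<lambda>h. (snd h, fst h))) (at (t, z))"
    by (auto intro!: derivative_eq_intros)
  ultimately have "((\<lambda>p. f (fst p) (snd p)) has_derivative
      (\<lambda>h. D_z f t z * snd h + fst h *\<^sub>R D_t f t z)) (at (t, z))"
    using has_derivative_compose[of "\<lambda>p. (snd p, fst p)" "\<lambda>h. (snd h, fst h)" "(t, z)" UNIV
        "\<lambda>p. f (snd p) (fst p)" "\<lambda>h. D_z f t z * fst h + snd h *\<^sub>R D_t f t z"] by simp
  then show ?thesis
    by (simp add: add.commute)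
qed

text \<open>Carrying the time along turns the whole family into one map between subsets of the same
  three-dimensional real space, so that invariance of domain applies and a single inverse contains
  the inverses of all \<open>w t\<close>.\<close>

definition graph_map :: "(real \<Rightarrow> complex \<Rightarrow> complex) \<Rightarrow> real \<times> complex \<Rightarrow> real \<times> complex" where
  "graph_map w = (\<lambda>(t, z). (t, w t z))"

lemma open_graph_map:
  assumes "C1_family D w" "\<And>t. inj_on (w t) (slice D t)" "open E" "E \<subseteq> D"
  shows "open (graph_map w ` E)"
proof (rule invariance_of_domain)
  show "continuous_on E (graph_map w)"
    unfolding graph_map_def case_prod_unfold
    by (intro continuous_intros continuous_on_subset[OF C1_family_continuous[OF assms(1)] assms(4)])
  show "inj_on (graph_map w) E"
  proof (rule inj_onI)
    fix p q assume pq: "p \<in> E" "q \<in> E" "graph_map w p = graph_map w q"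
    obtain t z u where "p = (t, z)" "q = (t, u)" "w t z = w t u"
      using pq(3) by (auto simp: graph_map_def split: prod.splits)
    then show "p = q"
      using inj_onD[OF assms(2), of t z u] pq assms(4) by auto
  qed
qed fact

text \<open>The derivative of \<open>graph_map w\<close> is block triangular with diagonal entries 1
  and \<open>D_z w t z\<close>; solving for the second component gives the stated inverse.\<close>

lemma has_derivative_inverse_graph_map:
  assumes "C1_family D w" "\<And>t. inj_on (w t) (slice D t)"
    and "(t, z) \<in> D" "D_z w t z \<noteq> 0"
  shows "((\<lambda>p. (fst p, the_inv_into (slice D (fst p)) (w (fst p)) (snd p))) has_derivative
          (\<lambda>h. (fst h, (snd h - fst h *\<^sub>R D_t w t z) / D_z w t z))) (at (t, w t z))"
    (is "(?g has_derivative ?g') _")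
proof -
  have g: "?g (graph_map w p) = p" if "p \<in> D" for p
    using that assms(2) by (auto simp: graph_map_def the_inv_into_f_f split: prod.splits)
  have oD: "open D" using C1_family_open[OF assms(1)] .
  have cont: "continuous_on D (graph_map w)"
    unfolding graph_map_def case_prod_unfold
    by (intro continuous_intros C1_family_continuous[OF assms(1)])
  have op: "open (graph_map w ` D)"
    using open_graph_map[OF assms(1,2) oD] by simp
  have mem: "(t, w t z) \<in> graph_map w ` D"
    using assms(3) by (force simp: graph_map_def)
  show ?thesis
  proof (rule has_derivative_inverse_basic)
    have "?g (t, w t z) = (t, z)"
      using g[OF assms(3)] by (simp add: graph_map_def)
    moreover have "(graph_map w has_derivative
        (\<lambda>h. (fst h, fst h *\<^sub>R D_t w t z + D_z w t z * snd h))) (at (t, z))"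
      unfolding graph_map_def case_prod_unfold
      by (intro has_derivative_Pair C1_family_has_derivative[OF assms(1,3)])
        (auto intro!: derivative_eq_intros)
    ultimately show "(graph_map w has_derivative
        (\<lambda>h. (fst h, fst h *\<^sub>R D_t w t z + D_z w t z * snd h))) (at (?g (t, w t z)))"
      by simp
    show "bounded_linear ?g'"
      by (intro bounded_linear_Pair bounded_linear_fst bounded_linear_divide[THEN bounded_linear_compose]
          bounded_linear_sub bounded_linear_snd bounded_linear_scaleR_left[THEN bounded_linear_compose])
    show "?g' \<circ> (\<lambda>h. (fst h, fst h *\<^sub>R D_t w t z + D_z w t z * snd h)) = id"
      using assms(4) by (auto simp: fun_eq_iff)
    \<comment> \<open>Differentiability of the inverse at a point presupposes its continuity there;
      this comes from invariance of domain.\<close>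
    have "continuous_on (graph_map w ` D) ?g"
      by (rule continuous_on_inverse_open[OF oD cont]) (use g in auto)
    then show "continuous (at (t, w t z)) ?g"
      using continuous_on_eq_continuous_at[OF op] mem by blast
    show "graph_map w (?g p) = p" if "p \<in> graph_map w ` D" for p
      using g that by (metis imageE)
  qed (fact op mem)+
qed

text \<open>Chain rule, with derivatives \<open>- D_t w / D_z w\<close> in time and
  \<open>1 / D_z w\<close> in space for the inverse of \<open>w t\<close>. The inverse is taken on
  the slices of \<open>D\<close>, as in \<open>schwarz_function\<close>, while \<open>f\<close> is
  controlled on the smaller set \<open>E\<close>.\<close>

lemma
  assumes "C1_family D w" "\<And>t. inj_on (w t) (slice D t)"
    and "C1_family E f" "E \<subseteq> D" "(t, z) \<in> E" "D_z w t z \<noteq> 0"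
  defines "F \<equiv> \<lambda>t \<zeta>. f t (the_inv_into (slice D t) (w t) \<zeta>)"
  shows D_t_transport: "D_t F t (w t z) = D_t f t z - D_z f t z * D_t w t z / D_z w t z"
    and D_z_transport: "D_z F t (w t z) = D_z f t z / D_z w t z"
proof -
  have D: "(t, z) \<in> D" using assms by auto
  have g0: "the_inv_into (slice D t) (w t) (w t z) = z"
    using D assms(2) by (simp add: the_inv_into_f_f)
  have F: "((\<lambda>p. F (fst p) (snd p)) has_derivative
      (\<lambda>h. fst h *\<^sub>R D_t f t z + D_z f t z * ((snd h - fst h *\<^sub>R D_t w t z) / D_z w t z)))
      (at (t, w t z))"
    using has_derivative_compose[OF has_derivative_inverse_graph_map[OF assms(1,2) D assms(6)],
        of "\<lambda>p. f (fst p) (snd p)", unfolded fst_conv snd_conv g0,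
        OF C1_family_has_derivative[OF assms(3,5)]]
    by (simp add: F_def)
  have "((\<lambda>s. (s, w t z)) has_derivative (\<lambda>h. (h, 0))) (at t)"
    by (auto intro!: derivative_eq_intros)
  from has_derivative_compose[OF this F]
  have "((\<lambda>s. F s (w t z)) has_vector_derivative
      D_t f t z - D_z f t z * D_t w t z / D_z w t z) (at t)"
    by (simp add: has_vector_derivative_def algebra_simps scaleR_conv_of_real)
  then show "D_t F t (w t z) = D_t f t z - D_z f t z * D_t w t z / D_z w t z"
    by (simp add: D_t_def vector_derivative_at)
  have "((\<lambda>\<zeta>. (t, \<zeta>)) has_derivative (\<lambda>h. (0, h))) (at (w t z))"
    by (auto intro!: derivative_eq_intros)
  from has_derivative_compose[OF this F]
  have "(F t has_derivative (\<lambda>h. D_z f t z / D_z w t z * h)) (at (w t z))"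
    by simp
  then have "(F t has_field_derivative D_z f t z / D_z w t z) (at (w t z))"
    by (simp only: has_field_derivative_def)
  then show "D_z F t (w t z) = D_z f t z / D_z w t z"
    by (simp add: D_z_def DERIV_imp_deriv)
qed

text \<open>Derivatives depend on local values only. This matters because formulas such as the one
  for \<open>D_t S\<close> hold merely on an open set and are differentiated again.\<close>

lemma D_t_cong:
  assumes "open G" "(t, y) \<in> G" "\<And>s y. (s, y) \<in> G \<Longrightarrow> f s y = g s y"
  shows "D_t f t y = D_t g t y"
proof -
  have "open ((\<lambda>s. (s, y)) -` G)"
    using assms(1) by (intro open_vimage continuous_intros)
  then have "\<forall>\<^sub>F s in nhds t. (s, y) \<in> G"
    using assms(2) by (auto simp: eventually_nhds)
  then have "\<forall>\<^sub>F s in nhds t. f s y = g s y"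
    by eventually_elim (rule assms(3))
  then show ?thesis
    unfolding D_t_def by (intro vector_derivative_cong_eq) (auto simp: assms)
qed

lemma D_z_cong:
  assumes "open G" "(t, z) \<in> G" "\<And>s y. (s, y) \<in> G \<Longrightarrow> f s y = g s y"
  shows "D_z f t z = D_z g t z"
proof -
  have "\<forall>\<^sub>F y in nhds z. y \<in> slice G t"
    using assms(2) by (intro eventually_nhds_in_open open_slice[OF assms(1)]) auto
  then have "\<forall>\<^sub>F y in nhds z. f t y = g t y"
    by eventually_elim (use assms(3) in auto)
  then show ?thesis
    unfolding D_z_def by (intro deriv_cong_ev) auto
qed

lemma C1_family_cong:
  assumes "C1_family D f" "\<And>t z. (t, z) \<in> D \<Longrightarrow> f t z = g t z"
  shows "C1_family D g"
proof -
  have eq: "D_t g t z = D_t f t z" if "(t, z) \<in> D" for t z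
    using D_t_cong[OF C1_family_open[OF assms(1)] that] assms(2) by metis
  have "g t holomorphic_on slice D t" for t
    using holomorphic_transform[OF C1_family_holomorphic[OF assms(1)], of t "g t"] assms(2) by simp
  moreover have "((\<lambda>s. g s z) has_vector_derivative D_t g t z) (at t)" if "(t, z) \<in> D" for t z
  proof -
    have "open ((\<lambda>s. (s, z)) -` D)"
      using C1_family_open[OF assms(1)] by (intro open_vimage continuous_intros)
    then show ?thesis
      unfolding eq[OF that] using that assms(2)
      by (intro has_vector_derivative_transform_within_open
          [OF C1_family_has_vector_derivative[OF assms(1) that]]) auto
  qed
  moreover have "continuous_on D (\<lambda>(t, z). g t z)" "continuous_on D (\<lambda>(t, z). D_t g t z)"
    using C1_family_continuous[OF assms(1)] C1_family_continuous_D_t[OF assms(1)] assms(2) eq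
    by (auto simp: case_prod_unfold cong: continuous_on_cong)
  ultimately show ?thesis
    using C1_family_open[OF assms(1)] by (auto simp: C1_family_def)
qed

section \<open>The geodesic equation in the parameter domain\<close>

locale curve_family =
  fixes I D w
  assumes family: "analytic_curve_family I D w"
begin

abbreviation W where "W \<equiv> \<lambda>t. conj_fun (w t)"

text \<open>The set where \<open>w\<close> and its conjugate family \<open>W\<close> are both under
  control. It is symmetric under conjugation, which \<open>D\<close> need not be, and still contains
  the real axis at all times in \<open>I\<close>.\<close>

definition E where "E = D \<inter> conj_domain D"

lemma
  shows open_D: "open D"
    and C1_w: "C1_family D w"
    and C1_w_t: "C1_family D (D_t w)"
    and inj: "inj_on (w t) (slice D t)"
    and nonzero: "(t, z) \<in> D \<Longrightarrow> D_z w t z \<noteq> 0"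
    and real_in: "t \<in> I \<Longrightarrow> (t, of_real x) \<in> D"
    and open_I: "open I"
proof -
  note f = family[unfolded analytic_curve_family_def]
  show oD: "open D" and "open I"
    using f by auto
  have t: "t \<in> I" if "(t, z) \<in> D" for t z
    using f that by auto
  show "t \<in> I \<Longrightarrow> (t, of_real x) \<in> D" for t x
    using f by (auto simp: subset_iff Reals_def)
  \<comment> \<open>Since \<open>D\<close> lies over \<open>I\<close>, the conditions assumed for
    \<open>t \<in> I\<close> extend trivially to all real \<open>t\<close>, as
    \<open>C1_family\<close> demands.\<close>
  have empty: "slice D t = {}" if "t \<notin> I" for t
    using t that by auto
  show inj: "inj_on (w t) (slice D t)" for t
    using f empty by (cases "t \<in> I") simp_all
  show "(t, z) \<in> D \<Longrightarrow> D_z w t z \<noteq> 0" for t z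
    using f t by (auto simp: D_z_def)
  have hol: "w t holomorphic_on slice D t" for t
    using f empty holomorphic_on_empty by (cases "t \<in> I") metis+
  have vd: "((\<lambda>s. w s z) has_vector_derivative D_t w t z) (at t)"
    "((\<lambda>s. D_t w s z) has_vector_derivative D_t (D_t w) t z) (at t)" if "(t, z) \<in> D" for t z
    using f that by (auto simp: D_t_def vector_derivative_works)
  show C1: "C1_family D w"
    using f vd hol unfolding C1_family_def by auto
  \<comment> \<open>Holomorphy of \<open>D_t w\<close> is the one ingredient absent from the
    definition of the family; it is the Weierstrass consequence.\<close>
  show "C1_family D (D_t w)"
    using f vd C1_family_holomorphic_D_t[OF C1] unfolding C1_family_def by auto
qed

lemma
  shows open_E: "open E"
    and E_subset: "E \<subseteq> D" "E \<subseteq> conj_domain D"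
    and E_iff: "(t, z) \<in> E \<longleftrightarrow> (t, z) \<in> D \<and> (t, cnj z) \<in> D"
  using open_conj_domain[OF open_D] open_D by (auto simp: E_def)

lemma real_in_E: "t \<in> I \<Longrightarrow> (t, of_real x) \<in> E"
  using real_in by (simp add: E_iff)

lemma
  shows C1_W: "C1_family E W" and C1_W_t: "C1_family E (D_t W)"
    and W_z_nonzero: "(t, z) \<in> E \<Longrightarrow> D_z W t z \<noteq> 0"
proof -
  show "C1_family E W"
    using C1_family_subset[OF C1_family_conj[OF C1_w] open_E E_subset(2)] .
  have eq: "D_t W s y = conj_fun (D_t w s) y" if "(s, y) \<in> E" for s y
    using that D_t_conj[OF C1_w] by (simp add: E_iff conj_fun_def)
  have C: "C1_family E (\<lambda>t. conj_fun (D_t w t))"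
    using C1_family_subset[OF C1_family_conj[OF C1_w_t] open_E E_subset(2)] .
  show "C1_family E (D_t W)"
    by (rule C1_family_cong[OF C]) (use eq in auto)
  show "(t, z) \<in> E \<Longrightarrow> D_z W t z \<noteq> 0"
    using D_z_conj[OF C1_w] nonzero by (simp add: E_iff)
qed

text \<open>\<open>velocity\<close> and \<open>acceleration\<close> are \<open>S\<^sub>t\<close> and \<open>\<nabla>\<close> of \<open>S\<^sub>t\<close> along itself, pulled back to the
  parameter domain by \<open>w t\<close>.\<close>

definition velocity where
  "velocity t z = D_t W t z - D_z W t z * D_t w t z / D_z w t z"

definition acceleration where
  "acceleration t z = D_t velocity t z - D_z velocity t z * D_t W t z / D_z W t z"

lemma
  shows C1_w_E: "C1_family E w" and C1_w_t_E: "C1_family E (D_t w)"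
  using C1_family_subset[OF C1_w open_E E_subset(1)]
    C1_family_subset[OF C1_w_t open_E E_subset(1)] .

lemma C1_velocity: "C1_family E velocity"
proof -
  have "C1_family E (\<lambda>t z. D_t W t z - D_z W t z * D_t w t z / D_z w t z)"
    using nonzero
    by (intro C1_family_diff C1_family_divide C1_family_mult C1_family_D_z C1_W C1_W_t C1_w_E C1_w_t_E)
      (simp add: E_iff)
  then show ?thesis
    by (simp add: velocity_def[abs_def])
qed

text \<open>Provides the hypothesis of the identity theorem, by which vanishing spreads from the
  real axis to discs around its points.\<close>

lemma acceleration_holomorphic: "acceleration t holomorphic_on slice E t"
  unfolding acceleration_def[abs_def] using W_z_nonzero
  by (intro holomorphic_intros C1_family_holomorphic_D_t C1_family_holomorphic_D_z C1_velocity C1_W) auto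

text \<open>Transport is applied twice, to \<open>W\<close> and then to \<open>velocity\<close>. In
  the difference of \<open>S_tt\<close> and \<open>S_t / S_z * S_tz\<close> the terms with
  \<open>D_t w\<close> cancel.\<close>

lemma nabla_self_eq_acceleration:
  assumes "(t, z) \<in> E"
  shows "nabla_self (schwarz_function D w) t (w t z) = acceleration t z"
proof -
  define S where "S = schwarz_function D w"
  define v where "v = (\<lambda>t. the_inv_into (slice D t) (w t))"
  have S: "S = (\<lambda>t \<zeta>. W t (v t \<zeta>))"
    by (auto simp: S_def v_def schwarz_function_def fun_eq_iff)
  have v: "v s (w s u) = u" if "(s, u) \<in> E" for s u
    using that inj unfolding v_def by (intro the_inv_into_f_f) (auto simp: E_iff)
  have nz: "D_z w s u \<noteq> 0" if "(s, u) \<in> E" for s u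
    using that nonzero by (simp add: E_iff)
  have "D_t S s (w s u) = velocity s u" if "(s, u) \<in> E" for s u
    using D_t_transport[OF C1_w inj C1_W E_subset(1) that nz[OF that]]
    by (simp add: S v_def velocity_def)
  \<comment> \<open>Stated on the whole open image of \<open>E\<close>, since this identity is
    differentiated once more in both variables.\<close>
  then have St: "D_t S s \<zeta> = velocity s (v s \<zeta>)" if "(s, \<zeta>) \<in> graph_map w ` E" for s \<zeta>
    using that v by (auto simp: graph_map_def)
  have G: "open (graph_map w ` E)"
    using open_graph_map[OF C1_w inj open_E E_subset(1)] .
  have mem: "(t, w t z) \<in> graph_map w ` E"
    using assms by (force simp: graph_map_def)
  have S_t: "D_t S t (w t z) = velocity t z"
    using St[OF mem] v[OF assms] by simp
  have S_tt: "D_t (D_t S) t (w t z) = D_t velocity t z - D_z velocity t z * D_t w t z / D_z w t z"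
    using D_t_cong[OF G mem St] D_t_transport[OF C1_w inj C1_velocity E_subset(1) assms nz[OF assms]]
    by (simp add: v_def)
  have S_tz: "D_z (D_t S) t (w t z) = D_z velocity t z / D_z w t z"
    using D_z_cong[OF G mem St] D_z_transport[OF C1_w inj C1_velocity E_subset(1) assms nz[OF assms]]
    by (simp add: v_def)
  have S_z: "D_z S t (w t z) = D_z W t z / D_z w t z"
    using D_z_transport[OF C1_w inj C1_W E_subset(1) assms nz[OF assms]] by (simp add: S v_def)
  show ?thesis
    unfolding S_def[symmetric] nabla_self_eq acceleration_def S_t S_tt S_tz S_z
    unfolding velocity_def[of t z] using nz[OF assms] W_z_nonzero[OF assms]
    by (simp add: field_simps)
qed

lemma
  assumes "(t, z) \<in> E"
  shows D_t_velocity: "D_t velocity t z = D_t (D_t W) t z -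
      ((D_z W t z * D_t (D_t w) t z + D_t (D_z W) t z * D_t w t z) / D_z w t z
       - D_z W t z * D_t w t z * D_t (D_z w) t z / (D_z w t z)^2)"
    and D_z_velocity: "D_z velocity t z = D_z (D_t W) t z -
      ((D_z W t z * D_z (D_t w) t z + D_z (D_z W) t z * D_t w t z) / D_z w t z
       - D_z W t z * D_t w t z * D_z (D_z w) t z / (D_z w t z)^2)"
proof -
  have nz: "D_z w t z \<noteq> 0"
    using assms nonzero by (simp add: E_iff)
  show "D_t velocity t z = D_t (D_t W) t z -
      ((D_z W t z * D_t (D_t w) t z + D_t (D_z W) t z * D_t w t z) / D_z w t z
       - D_z W t z * D_t w t z * D_t (D_z w) t z / (D_z w t z)^2)"
    unfolding D_t_def[of velocity] unfolding velocity_def using nz assms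
    by (intro vector_derivative_at has_vector_derivative_diff has_vector_derivative_divide_complex
        has_vector_derivative_mult C1_family_has_vector_derivative C1_family_D_z)
      (auto intro: C1_W C1_W_t C1_w_E C1_w_t_E)
  note der = C1_family_has_field_derivative[OF _ assms]
  have "(velocity t has_field_derivative D_z (D_t W) t z -
      ((D_z W t z * D_z (D_t w) t z + D_z (D_z W) t z * D_t w t z) / D_z w t z
       - D_z W t z * D_t w t z * D_z (D_z w) t z / (D_z w t z)^2)) (at z)"
    unfolding velocity_def[abs_def] using nz
    by (auto intro!: derivative_eq_intros der C1_family_D_z C1_W C1_W_t C1_w_E C1_w_t_E
        simp: field_simps power2_eq_square)
  then show "D_z velocity t z = D_z (D_t W) t z -
      ((D_z W t z * D_z (D_t w) t z + D_z (D_z W) t z * D_t w t z) / D_z w t z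
       - D_z W t z * D_t w t z * D_z (D_z w) t z / (D_z w t z)^2)"
    unfolding D_z_def[of velocity] by (rule DERIV_imp_deriv)
qed

section \<open>Values on the real axis\<close>

lemma
  assumes "t \<in> I"
  shows D_x_real: "D_x (real_param w) t x = D_z w t (of_real x)"
    and D_x_x_real: "D_x (D_x (real_param w)) t x = D_z (D_z w) t (of_real x)"
    and D_x_t_real: "D_t (D_x (real_param w)) t x = D_t (D_z w) t (of_real x)"
proof -
  have D_x: "D_x (\<lambda>t x. f t (of_real x)) s y = D_z f s (of_real y)"
    if "C1_family D f" "s \<in> I" for f s y
    unfolding D_x_def
    by (intro vector_derivative_at has_vector_derivative_real_field
        C1_family_has_field_derivative[OF that(1) real_in[OF that(2)]])
  have eq: "D_x (real_param w) s y = D_z w s (of_real y)" if "s \<in> I" for s y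
    using D_x[OF C1_w that] by (simp add: real_param_def[abs_def])
  show "D_x (real_param w) t x = D_z w t (of_real x)"
    using eq[OF assms] .
  have "D_x (real_param w) t = (\<lambda>x. D_z w t (of_real x))"
    using eq[OF assms] by (rule ext)
  then have "D_x (D_x (real_param w)) t x = D_x (\<lambda>t x. D_z w t (of_real x)) t x"
    by (simp only: D_x_def[of _ t x])
  then show "D_x (D_x (real_param w)) t x = D_z (D_z w) t (of_real x)"
    using D_x[OF C1_family_D_z[OF C1_w] assms] by simp
  \<comment> \<open>The time derivative involves the formula at neighbouring times, which lie in the
    open set \<open>I\<close>.\<close>
  have "D_t (D_x (real_param w)) t x = D_t (\<lambda>t x. D_z w t (of_real x)) t x"
    by (rule D_t_cong[of "I \<times> UNIV"]) (use assms eq open_I in \<open>auto intro: open_Times\<close>)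
  then show "D_t (D_x (real_param w)) t x = D_t (D_z w) t (of_real x)"
    by (simp add: D_t_def)
qed

lemma D_t_real:
  shows "D_t (real_param w) t x = D_t w t (of_real x)"
    and "D_t (D_t (real_param w)) t x = D_t (D_t w) t (of_real x)"
  by (simp_all add: D_t_def real_param_def)

text \<open>A real point is its own conjugate. For the second derivatives, the first derivatives of
  \<open>W\<close> are first identified with conjugate families on the open set \<open>E\<close>,
  then differentiated.\<close>

lemma
  assumes "t \<in> I"
  shows W_z_real: "D_z W t (of_real x) = cnj (D_z w t (of_real x))"
    and W_t_real: "D_t W t (of_real x) = cnj (D_t w t (of_real x))"
    and W_zz_real: "D_z (D_z W) t (of_real x) = cnj (D_z (D_z w) t (of_real x))"
    and W_zt_real: "D_t (D_z W) t (of_real x) = cnj (D_t (D_z w) t (of_real x))"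
    and W_tt_real: "D_t (D_t W) t (of_real x) = cnj (D_t (D_t w) t (of_real x))"
proof -
  have D: "(t, cnj (of_real x)) \<in> D"
    using real_in[OF assms] by simp
  show "D_z W t (of_real x) = cnj (D_z w t (of_real x))"
    "D_t W t (of_real x) = cnj (D_t w t (of_real x))"
    using D_z_conj[OF C1_w D] D_t_conj[OF C1_w D] by simp_all
  have z: "D_z W s u = conj_fun (D_z w s) u" and t: "D_t W s u = conj_fun (D_t w s) u"
    if "(s, u) \<in> E" for s u
    using that D_z_conj[OF C1_w] D_t_conj[OF C1_w] by (simp_all add: E_iff conj_fun_def)
  note E = real_in_E[OF assms, of x]
  show "D_z (D_z W) t (of_real x) = cnj (D_z (D_z w) t (of_real x))"
    using D_z_cong[OF open_E E z] D_z_conj[OF C1_family_D_z[OF C1_w] D] by simp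
  show "D_t (D_z W) t (of_real x) = cnj (D_t (D_z w) t (of_real x))"
    using D_t_cong[OF open_E E z] D_t_conj[OF C1_family_D_z[OF C1_w] D] by simp
  show "D_t (D_t W) t (of_real x) = cnj (D_t (D_t w) t (of_real x))"
    using D_t_cong[OF open_E E t] D_t_conj[OF C1_w_t D] by simp
qed

text \<open>The factor is a common denominator of all terms of the acceleration on the real axis.
  The resulting terms pair off into conjugates with opposite signs.\<close>

lemma acceleration_real:
  assumes "t \<in> I"
  shows "acceleration t (of_real x) * ((D_z w t (of_real x))^2 * cnj (D_z w t (of_real x))) =
    cnj (Q (real_param w) t x) - Q (real_param w) t x"
proof -
  note E = real_in_E[OF assms, of x]
  have nz: "D_z w t (of_real x) \<noteq> 0"
    using nonzero real_in[OF assms] by simp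
  \<comment> \<open>\<open>D_z velocity\<close> produces the mixed derivatives in the other order
    than \<open>Q\<close>.\<close>
  have zt: "D_z (D_t w) t (of_real x) = D_t (D_z w) t (of_real x)"
    "D_z (D_t W) t (of_real x) = D_t (D_z W) t (of_real x)"
    using D_t_D_z[OF C1_w_E E] D_t_D_z[OF C1_W E] by simp_all
  show ?thesis
    unfolding acceleration_def D_t_velocity[OF E] D_z_velocity[OF E] Q_def Let_def D_t_real D_x_real[OF assms]
      D_x_x_real[OF assms] D_x_t_real[OF assms] zt W_z_real[OF assms] W_t_real[OF assms]
      W_zz_real[OF assms] W_zt_real[OF assms] W_tt_real[OF assms]
    using nz by (simp add: field_simps power2_eq_square)
qed

lemma acceleration_real_eq_0_iff:
  assumes "t \<in> I"
  shows "acceleration t (of_real x) = 0 \<longleftrightarrow> Im (Q (real_param w) t x) = 0"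
proof -
  have "D_z w t (of_real x) \<noteq> 0"
    using nonzero real_in[OF assms] by simp
  then have "acceleration t (of_real x) = 0 \<longleftrightarrow> cnj (Q (real_param w) t x) - Q (real_param w) t x = 0"
    unfolding acceleration_real[OF assms, symmetric] by simp
  also have "\<dots> \<longleftrightarrow> Im (Q (real_param w) t x) = 0"
    by (auto simp: complex_eq_iff)
  finally show ?thesis .
qed

section \<open>Equivalence of the geodesic equation with the equation for \<open>Q\<close>\<close>

lemma geodesic_iff:
  "represents_geodesic I (curve w) (schwarz_function D w) \<longleftrightarrow>
   (\<forall>t\<in>I. \<forall>x. Im (Q (real_param w) t x) = 0)"
proof
  assume geo: "represents_geodesic I (curve w) (schwarz_function D w)"
  show "\<forall>t\<in>I. \<forall>x. Im (Q (real_param w) t x) = 0"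
  proof (intro ballI allI)
    fix t x assume "t \<in> I"
    then have "nabla_self (schwarz_function D w) t (w t (of_real x)) = 0"
      using geo by (fastforce simp: represents_geodesic_def curve_def real_param_def)
    then show "Im (Q (real_param w) t x) = 0"
      using nabla_self_eq_acceleration[OF real_in_E] acceleration_real_eq_0_iff \<open>t \<in> I\<close> by simp
  qed
next
  assume Q: "\<forall>t\<in>I. \<forall>x. Im (Q (real_param w) t x) = 0"
  show "represents_geodesic I (curve w) (schwarz_function D w)"
    unfolding represents_geodesic_def
  proof (rule ballI)
    fix t assume t: "t \<in> I"
    \<comment> \<open>The slice may be disconnected, so the identity theorem is applied on a
      separate disc about each real point.\<close>
    have "\<exists>r>0. ball (complex_of_real x) r \<subseteq> slice E t" for x
      using open_slice[OF open_E] real_in_E[OF t] by (auto simp: open_contains_ball)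
    then obtain r where r: "\<And>x. r x > 0" "\<And>x. ball (complex_of_real x) (r x) \<subseteq> slice E t"
      by metis
    have acceleration_0: "acceleration t z = 0" if "z \<in> ball (complex_of_real x) (r x)" for x z
    proof (rule analytic_continuation[where f = "acceleration t"])
      show "acceleration t holomorphic_on ball (of_real x) (r x)"
        using acceleration_holomorphic r(2) by (rule holomorphic_on_subset)
      \<comment> \<open>The zeros on the real axis accumulate at the centre of the disc.\<close>
      show "complex_of_real x islimpt \<real> \<inter> ball (of_real x) (r x)"
      proof -
        have "complex_of_real x islimpt \<real>"
          unfolding islimpt_approachable
        proof (intro allI impI)
          fix e :: real assume "e > 0"
          then show "\<exists>y\<in>\<real>. y \<noteq> complex_of_real x \<and> dist y (of_real x) < e"
            by (intro bexI[of _ "of_real (x + e / 2)"]) (auto simp: dist_of_real dist_real_def simp del: of_real_add)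
        qed
        then show ?thesis
          by (intro islimpt_Int_eventually eventually_at_in_open') (use r(1) in auto)
      qed
      show "acceleration t y = 0" if "y \<in> \<real> \<inter> ball (of_real x) (r x)" for y
        using that Q t acceleration_real_eq_0_iff[OF t] by (auto elim!: Reals_cases)
    qed (use that r(1) in auto)
    \<comment> \<open>The image of \<open>B\<close> under the injective holomorphic map
      \<open>w t\<close> is open and contains the curve: it is the required neighbourhood.\<close>
    define B where "B = (\<Union>x. ball (complex_of_real x) (r x))"
    have B: "open B" "B \<subseteq> slice D t"
      using r(2) E_subset(1) by (fastforce simp: B_def)+
    have "open (w t ` B)"
      using C1_family_holomorphic[OF C1_w, of t] inj[of t] B
      by (intro open_mapping_thm3) (auto intro: holomorphic_on_subset inj_on_subset)
    moreover have "of_real x \<in> B" for x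
      unfolding B_def using r(1)[of x] by (intro UN_I[of x]) auto
    then have "curve w t \<subseteq> w t ` B"
      by (auto simp: curve_def real_param_def)
    moreover have "nabla_self (schwarz_function D w) t \<zeta> = 0" if "\<zeta> \<in> w t ` B" for \<zeta>
    proof -
      obtain x z where xz: "z \<in> ball (complex_of_real x) (r x)" "\<zeta> = w t z"
        using \<open>\<zeta> \<in> w t ` B\<close> unfolding B_def by blast
      then have "(t, z) \<in> E" using r(2)[of x] by auto
      then show ?thesis
        using nabla_self_eq_acceleration acceleration_0[OF xz(1)] xz(2) by simp
    qed
    ultimately show "\<exists>U. open U \<and> curve w t \<subseteq> U \<and>
        (\<forall>z\<in>U. nabla_self (schwarz_function D w) t z = 0)"
      by blast
  qed
qed

end

section \<open>Normal motion\<close>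

lemma normal_system_iff:
  "D_x u t x \<bullet> D_t u t x = 0 \<and> Im (Q u t x) = 0 \<longleftrightarrow> normal_system u t x"
proof -
  define ux ut uxx uxt utt where defs: "ux = D_x u t x" "ut = D_t u t x"
    "uxx = D_x (D_x u) t x" "uxt = D_t (D_x u) t x" "utt = D_t (D_t u) t x"
  have "ut * cnj ux + cnj ut * ux = of_real (2 * (ux \<bullet> ut))"
    by (simp add: complex_eq_iff inner_complex_def)
  then have normal: "ux \<bullet> ut = 0 \<longleftrightarrow> ut * cnj ux + cnj ut * ux = 0"
    by (simp only: of_real_eq_0_iff) simp
  have "Q u t x = cnj ux * (of_real ((cmod ux)^2) * utt + of_real ((cmod ut)^2) * uxx)"
    if "ut * cnj ux + cnj ut * ux = 0"
  proof -
    \<comment> \<open>The coefficient of \<open>cnj uxt\<close> is \<open>ux\<close> times the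
      left-hand side of the normality equation, hence vanishes.\<close>
    have "Q u t x = cnj ux * ((ux * cnj ux) * utt + (ut * cnj ut) * uxx)
        + ux * (ut * cnj ux + cnj ut * ux) * cnj uxt"
      by (simp add: Q_def Let_def defs algebra_simps power2_eq_square)
    then show ?thesis
      using that by (simp add: complex_norm_square flip: of_real_power)
  qed
  then show ?thesis
    using normal unfolding normal_system_def Let_def defs[symmetric] by auto
qed

theorem corollary16:
  fixes I :: "real set"
    and D :: "(real \<times> complex) set"
    and w :: "real \<Rightarrow> complex \<Rightarrow> complex"
  assumes "analytic_curve_family I D w"
  shows "(represents_geodesic I (curve w) (schwarz_function D w) \<longleftrightarrow>
            (\<forall>t\<in>I. \<forall>x. Im (Q (real_param w) t x) = 0)) \<and>
         (normal_motion I (real_param w) \<and> (\<forall>t\<in>I. \<forall>x. Im (Q (real_param w) t x) = 0) \<longleftrightarrow>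
            (\<forall>t\<in>I. \<forall>x. normal_system (real_param w) t x))"
proof -
  interpret curve_family I D w
    by unfold_locales fact
  show ?thesis
    using geodesic_iff normal_system_iff unfolding normal_motion_def by blast
qed

end
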